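(* Let $\kappa\ge2$ be an integer, $\rho\in(0,1)$, $\mathcal{E}\in(\rho,\kappa\rho)$, $\alpha_e=0$ and $\alpha_p\neq0$. Then the coupling matrices satisfy $$\mathbf{G}^1_{11}=\mathbf{G}^1_{22}=\mathbf{G}^2_{11}=0\qquad\text{while}\qquad\mathbf{G}^2_{22}\neq0.$$
   Context: Let $$\chi(\rho,\mathcal{E})=\begin{pmatrix}\rho(1-\rho)&\mathcal{E}(1-\rho)\\ \mathcal{E}(1-\rho)&\frac{(\mathcal{E}-\rho)(\kappa\rho-\mathcal{E})}{(\kappa-1)\rho}+\frac{(1-\rho)\mathcal{E}^2}{\rho}\end{pmatrix},\qquad \mathbf{j}(\rho,\mathcal{E})=(\kappa-1)\chi(\rho,\mathcal{E})\begin{pmatrix}\alpha_p\\ \alpha_e\end{pmatrix}.$$ $\mathbf{J}$ is the Jacobian matrix of $\mathbf{j}$ with respect to $(\rho,\mathcal{E})$ and $\mathbf{H}^i$ ($i=1,2$) is the Hessian matrix of the coordinate $\mathbf{j}_i$. $R$ is the $2\times2$ matrix whose rows are left eigenvectors of $\mathbf{J}$, so that $R\mathbf{J}R^{-1}=\mathrm{diag}(\lambda_1,\lambda_2)$. When $\alpha_e=0$ the eigenvalues are indexed as $\lambda_1=\alpha_p(\kappa-1)(1-\rho)$ and $\lambda_2=\alpha_p(\kappa-1)(1-2\rho)$, with left eigenvectors $\begin{pmatrix}1&-\frac{\rho}{\mathcal{E}}\end{pmatrix}$ and $\begin{pmatrix}1&0\end{pmatrix}$ as first and second rows of $R$. The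 coupling matrices are $$\mathbf{G}^i=\frac12\sum_{j=1}^2R_{ij}(R^{-1})^\top\mathbf{H}^jR^{-1},\qquad i=1,2.$$ *)

theory Defs
  imports "HOL-Analysis.Analysis"
begin

text \<open>
  States are vectors \<open>u :: real^2\<close> with \<open>u $ 1 = \<rho>\<close> and \<open>u $ 2 = \<E>\<close>.
\<close>

definition chi_matrix :: "real \<Rightarrow> real^2 \<Rightarrow> real^2^2" where
  "chi_matrix \<kappa> u = (let r = u $ 1; e = u $ 2 in
     vector [vector [r * (1 - r), e * (1 - r)],
             vector [e * (1 - r),
                     (e - r) * (\<kappa> * r - e) / ((\<kappa> - 1) * r) + (1 - r) * e\<^sup>2 / r]])"

definition current :: "real \<Rightarrow> real \<Rightarrow> real \<Rightarrow> real^2 \<Rightarrow> real^2" where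
  "current \<kappa> \<alpha>p \<alpha>e u = (\<kappa> - 1) *\<^sub>R (chi_matrix \<kappa> u *v vector [\<alpha>p, \<alpha>e])"

definition gradient :: "(real^'n \<Rightarrow> real) \<Rightarrow> real^'n \<Rightarrow> real^'n" where
  "gradient f u = (\<chi> i. frechet_derivative f (at u) (axis i 1))"

definition hessian :: "(real^'n \<Rightarrow> real) \<Rightarrow> real^'n \<Rightarrow> real^'n^'n" where
  "hessian f u = jacobian (gradient f) (at u)"

definition coupling_matrix ::
  "real^'n^'n \<Rightarrow> (real^'n \<Rightarrow> real^'n) \<Rightarrow> real^'n \<Rightarrow> 'n \<Rightarrow> real^'n^'n" where
  "coupling_matrix R f u i = (1 / 2) *\<^sub>R (\<Sum>j\<in>UNIV. R $ i $ j *\<^sub>R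
     (transpose (matrix_inv R) ** hessian (\<lambda>v. f v $ j) u ** matrix_inv R))"

text \<open>
  The rows are the left eigenvectors of the Jacobian of \<open>current \<kappa> \<alpha>p 0\<close>, in the order
  \<open>\<lambda>\<^sub>1 = \<alpha>p (\<kappa> - 1) (1 - \<rho>)\<close>, \<open>\<lambda>\<^sub>2 = \<alpha>p (\<kappa> - 1) (1 - 2 \<rho>)\<close>; see the two lemmas
  \<open>eigen_rows_left_eigenvector\<close> and \<open>eigen_rows_diagonalizes\<close> below.
\<close>

definition eigen_rows :: "real^2 \<Rightarrow> real^2^2" where
  "eigen_rows u = vector [vector [1, - (u $ 1) / (u $ 2)], vector [1, 0]]"

definition mode_speeds :: "real \<Rightarrow> real \<Rightarrow> real^2 \<Rightarrow> real^2" where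
  "mode_speeds \<kappa> \<alpha>p u =
     vector [\<alpha>p * (\<kappa> - 1) * (1 - u $ 1), \<alpha>p * (\<kappa> - 1) * (1 - 2 * u $ 1)]"

lemma current_zero_field:
  "current \<kappa> \<alpha>p 0 u =
     vector [(\<kappa> - 1) * \<alpha>p * (u $ 1 * (1 - u $ 1)), (\<kappa> - 1) * \<alpha>p * (u $ 2 * (1 - u $ 1))]"
  by (simp add: vec_eq_iff forall_2 current_def chi_matrix_def Let_def
      matrix_vector_mult_def sum_2 algebra_simps)

lemma jacobian_current_zero_field:
  "jacobian (current \<kappa> \<alpha>p 0) (at u) =
     vector [vector [(\<kappa> - 1) * \<alpha>p * (1 - 2 * u $ 1), 0],
             vector [- ((\<kappa> - 1) * \<alpha>p * u $ 2), (\<kappa> - 1) * \<alpha>p * (1 - u $ 1)]]"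
proof -
  define D :: "real^2 \<Rightarrow> real^2" where
    "D = (\<lambda>h. vector [(\<kappa> - 1) * \<alpha>p * (1 - 2 * u $ 1) * h $ 1,
                 (\<kappa> - 1) * \<alpha>p * ((1 - u $ 1) * h $ 2 - u $ 2 * h $ 1)])"
  have nth: "((\<lambda>v::real^2. v $ k) has_derivative (\<lambda>h. h $ k)) (at u)" for k
    by (rule bounded_linear_imp_has_derivative) (rule bounded_linear_vec_nth)
  have "(current \<kappa> \<alpha>p 0 has_derivative D) (at u)"
  proof (subst has_derivative_componentwise_within, rule ballI)
    fix b :: "real^2" assume "b \<in> Basis"
    then obtain k where b: "b = axis k 1" by (auto simp: Basis_vec_def)
    have "((\<lambda>v. current \<kappa> \<alpha>p 0 v $ k) has_derivative (\<lambda>h. D h $ k)) (at u)"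
      using exhaust_2[of k]
      by (auto simp: current_zero_field D_def algebra_simps
          intro!: derivative_eq_intros nth)
    then show "((\<lambda>v. current \<kappa> \<alpha>p 0 v \<bullet> b) has_derivative (\<lambda>h. D h \<bullet> b)) (at u)"
      by (simp add: b inner_axis)
  qed
  then have "frechet_derivative (current \<kappa> \<alpha>p 0) (at u) = D"
    by (metis frechet_derivative_at)
  then show ?thesis
    by (simp add: jacobian_def matrix_def vec_eq_iff forall_2 D_def axis_def)
qed

lemma eigen_rows_left_eigenvector:
  assumes "u $ 2 \<noteq> 0"
  shows "eigen_rows u $ i v* jacobian (current \<kappa> \<alpha>p 0) (at u) =
    mode_speeds \<kappa> \<alpha>p u $ i *\<^sub>R eigen_rows u $ i"
  using exhaust_2[of i] assms
  by (auto simp: eigen_rows_def mode_speeds_def jacobian_current_zero_field vec_eq_iff forall_2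
      vector_matrix_mult_def sum_2 field_simps)

lemma eigen_rows_diagonalizes:
  assumes "u $ 1 \<noteq> 0" "u $ 2 \<noteq> 0"
  shows "invertible (eigen_rows u)"
    and "eigen_rows u ** jacobian (current \<kappa> \<alpha>p 0) (at u) ** matrix_inv (eigen_rows u) =
      (\<chi> i j. if i = j then mode_speeds \<kappa> \<alpha>p u $ i else 0)"
proof -
  let ?D = "(\<chi> i j. if i = j then mode_speeds \<kappa> \<alpha>p u $ i else 0) :: real^2^2"
  show inv: "invertible (eigen_rows u)"
    using assms by (simp add: invertible_det_nz det_2 eigen_rows_def)
  have "eigen_rows u ** jacobian (current \<kappa> \<alpha>p 0) (at u) = ?D ** eigen_rows u"
    using assms
    by (simp add: eigen_rows_def mode_speeds_def jacobian_current_zero_field vec_eq_iff forall_2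
        matrix_matrix_mult_def sum_2 field_simps)
  moreover have "eigen_rows u ** matrix_inv (eigen_rows u) = mat 1"
    using someI_ex[OF inv[unfolded invertible_def]] by (simp add: matrix_inv_def)
  ultimately show
    "eigen_rows u ** jacobian (current \<kappa> \<alpha>p 0) (at u) ** matrix_inv (eigen_rows u) = ?D"
    by (simp add: matrix_mul_assoc[symmetric])
qed

end

theory Submission
  imports Defs
begin

text \<open>
  At \<open>\<alpha>e = 0\<close> both components of the current have the form \<open>c * (v $ i * (1 - v $ 1))\<close> with
  \<open>c = (\<kappa> - 1) * \<alpha>p\<close>, so the Hessians are constant. The columns of the inverse of \<open>eigen_rows\<close>
  are \<open>(0, -\<E>/\<rho>)\<close> and \<open>(1, \<E>/\<rho>)\<close>; both Hessians vanish on the first one and take the values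
  \<open>-2c\<close> and \<open>-2c\<E>/\<rho>\<close> on the second, which cancel under the first row of \<open>eigen_rows\<close> and leave
  \<open>-c\<close> under the second.
\<close>

lemma has_derivative_vec_nth [derivative_intros]:
  "((\<lambda>v::real^'n. v $ k) has_derivative (\<lambda>h. h $ k)) F"
  by (rule bounded_linear_imp_has_derivative) (rule bounded_linear_vec_nth)

lemma gradient_eqI:
  "(f has_derivative D) (at u) \<Longrightarrow> gradient f u = (\<chi> i. D (axis i 1))"
  by (metis gradient_def frechet_derivative_at)

text \<open>Pairing with a basis vector picks out a coordinate, so differentiating the gradient
  entry by entry suffices; row \<open>k\<close> belongs to that entry, column \<open>l\<close> to
  the direction.\<close>

lemma hessian_eqI:
  fixes f :: "real^'n \<Rightarrow> real"
  assumes "\<And>k. ((\<lambda>v. gradient f v $ k) has_derivative D k) (at u)"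
  shows "hessian f u = (\<chi> k l. D k (axis l 1))"
proof -
  have "(gradient f has_derivative (\<lambda>h. \<chi> k. D k h)) (at u)"
  proof (subst has_derivative_componentwise_within, rule ballI)
    fix b :: "real^'n" assume "b \<in> Basis"
    then obtain k where "b = axis k 1" by (auto simp: Basis_vec_def)
    then show "((\<lambda>v. gradient f v \<bullet> b) has_derivative (\<lambda>h. (\<chi> k. D k h) \<bullet> b)) (at u)"
      using assms[of k] by (simp add: inner_axis)
  qed
  then have "frechet_derivative (gradient f) (at u) = (\<lambda>h. \<chi> k. D k h)"
    by (metis frechet_derivative_at)
  then show ?thesis
    by (simp add: hessian_def jacobian_def matrix_def)
qed

text \<open>Product rule, with \<open>axis k 1 $ i\<close> serving as a Kronecker delta. The result
  is affine in \<open>v\<close>, which makes the Hessian constant.\<close>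

lemma gradient_exclusion_flux:
  fixes v :: "real^'n"
  shows "gradient (\<lambda>v. c * (v $ i * (1 - v $ p))) v =
    (\<chi> k. c * (axis k 1 $ i * (1 - v $ p) - v $ i * axis k 1 $ p))"
proof -
  have "((\<lambda>v::real^'n. c * (v $ i * (1 - v $ p))) has_derivative
      (\<lambda>h. c * (h $ i * (1 - v $ p) - v $ i * h $ p))) (at v)"
    by (auto intro!: derivative_eq_intros simp: algebra_simps)
  then show ?thesis by (rule gradient_eqI)
qed

lemma hessian_exclusion_flux:
  fixes u :: "real^'n"
  shows "hessian (\<lambda>v. c * (v $ i * (1 - v $ p))) u =
    (\<chi> k l. - c * (axis k 1 $ i * axis l 1 $ p + axis l 1 $ i * axis k 1 $ p))"
proof -
  have "((\<lambda>v::real^'n. gradient (\<lambda>v. c * (v $ i * (1 - v $ p))) v $ k) has_derivative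
      (\<lambda>h. - c * (axis k 1 $ i * h $ p + h $ i * axis k 1 $ p))) (at u)" for k
    unfolding gradient_exclusion_flux vec_lambda_beta
    by (auto intro!: derivative_eq_intros simp: algebra_simps)
  then show ?thesis by (rule hessian_eqI)
qed

lemma current_zero_field_nth:
  "current \<kappa> \<alpha>p 0 v $ i = (\<kappa> - 1) * \<alpha>p * (v $ i * (1 - v $ 1))"
  using exhaust_2[of i] by (auto simp: current_zero_field)

text \<open>For square matrices a right inverse is also a left inverse, so \<open>B\<close>
  witnesses the choice in \<open>matrix_inv\<close>, and two-sided inverses agree.\<close>

lemma matrix_inv_unique:
  fixes A B :: "real^'n^'n"
  assumes "A ** B = mat 1"
  shows "matrix_inv A = B"
proof -
  have "B ** A = mat 1"
    using assms matrix_left_right_inverse by blast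
  then have "matrix_inv A ** A = mat 1"
    unfolding matrix_inv_def using assms by (metis (mono_tags, lifting) someI)
  then have "B = matrix_inv A ** (A ** B)"
    by (simp add: matrix_mul_assoc)
  then show ?thesis
    by (simp add: assms)
qed

lemma matrix_inv_eigen_rows:
  assumes "u $ 1 \<noteq> 0" "u $ 2 \<noteq> 0"
  shows "matrix_inv (eigen_rows u) =
    vector [vector [0, 1], vector [- (u $ 2 / u $ 1), u $ 2 / u $ 1]]"
  using assms
  by (intro matrix_inv_unique)
    (simp add: eigen_rows_def vec_eq_iff forall_2 matrix_matrix_mult_def sum_2 mat_def)

theorem proposition45:
  fixes \<kappa> :: nat and \<rho> \<E> \<alpha>p \<alpha>e :: real and u :: "real^2"
    and G :: "2 \<Rightarrow> real^2^2"
  assumes "\<kappa> \<ge> 2"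
    and "\<rho> \<in> {0<..<1}"
    and "\<E> \<in> {\<rho><..<real \<kappa> * \<rho>}"
    and "\<alpha>e = 0"
    and "\<alpha>p \<noteq> 0"
  defines "u \<equiv> vector [\<rho>, \<E>]"
  defines "G \<equiv> coupling_matrix (eigen_rows u) (current (real \<kappa>) \<alpha>p \<alpha>e) u"
  shows "G 1 $ 1 $ 1 = 0 \<and> G 1 $ 2 $ 2 = 0 \<and> G 2 $ 1 $ 1 = 0 \<and> G 2 $ 2 $ 2 \<noteq> 0"
proof -
  define c where "c = (real \<kappa> - 1) * \<alpha>p"
  have u: "u $ 1 = \<rho>" "u $ 2 = \<E>" by (simp_all add: u_def)
  \<comment> \<open>Here \<open>\<E> > \<rho> > 0\<close>, and \<open>\<kappa> \<ge> 2\<close> keeps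
    the factor \<open>\<kappa> - 1\<close> of \<open>c\<close> positive.\<close>
  have nz: "\<rho> \<noteq> 0" "\<E> \<noteq> 0" "c \<noteq> 0"
    using assms(1-5) by (auto simp: c_def)
  have hess: "hessian (\<lambda>v. current (real \<kappa>) \<alpha>p \<alpha>e v $ j) u =
      (\<chi> k l. - c * (axis k 1 $ j * axis l 1 $ 1 + axis l 1 $ j * axis k 1 $ 1))" for j
    unfolding \<open>\<alpha>e = 0\<close> current_zero_field_nth c_def by (rule hessian_exclusion_flux)
  have inv: "matrix_inv (eigen_rows u) = vector [vector [0, 1], vector [- (\<E> / \<rho>), \<E> / \<rho>]]"
    using matrix_inv_eigen_rows[of u] nz u by simp
  \<comment> \<open>The second row \<open>(1, 0)\<close> keeps only the first Hessian, whose value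
    \<open>-2c\<close> is halved by the prefactor.\<close>
  have "G 1 $ 1 $ 1 = 0" "G 1 $ 2 $ 2 = 0" "G 2 $ 1 $ 1 = 0" "G 2 $ 2 $ 2 = - c"
    unfolding G_def coupling_matrix_def hess inv using nz
    by (simp_all add: eigen_rows_def u sum_2 matrix_matrix_mult_def transpose_def axis_def)
  with nz show ?thesis by simp
qed

end
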